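(* Let $(M^{3},\varphi,\xi,\eta,g)$ be a three-dimensional para-Sasakian manifold with scalar curvature $r$. Suppose that $M$ admits a Yamabe soliton, i.e. there are a vector field $V$ and a real number $\lambda$ with $\mathcal{L}_Vg=(\lambda-r)g$, and that $V$ is pointwise collinear with the structure vector field $\xi$, i.e. $V=b\xi$ for some smooth function $b$ on $M$. Then $V$ is a constant multiple of $\xi$ (that is, $b$ is constant).
   Context: All manifolds are smooth and connected. An almost paracontact structure on a $(2n+1)$-dimensional manifold $M$ consists of a $(1,1)$-tensor field $\varphi$, a vector field $\xi$ and a $1$-form $\eta$ with $\eta(\xi)=1$, $\varphi^2=I-\eta\otimes\xi$, such that the $\pm1$-eigendistributions of $\varphi$ restricted to $\ker\eta$ both have dimension $n$ (so $\varphi\xi=0$, $\eta\circ\varphi=0$). It is an almost paracontact metric manifold if equipped with a semi-Riemannian metric $g$ with $g(\varphi X,\varphi Y)=-g(X,Y)+\eta(X)\eta(Y)$ for all $X,Y$. Its fundamental $2$-form is $\Phi(X,Y)=g(X,\varphi Y)$. It is normal if $[\varphi,\varphi]-2d\eta\otimes\xi=0$, where $[\varphi,\varphi](X,Y)=\varphi^2[X,Y]+[\varphi X,\varphi Y]-\varphi[\varphi X,Y]-\varphi[X,\varphi Y]$, and it is a paracontact metric manifold if $d\eta=\Phi$; here $2\,d\eta(X,Y)=X\eta(Y)-Y\eta(X)-\eta([X,Y])$. A para-Sasakian manifold is a normal paracontact metric manifold; with these conventions it satisfies $\nabla_X\xi=-\varphi X$ and $(\nabla_X\varphi)Y=-g(X,Y)\xi+\eta(Y)X$,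 where $\nabla$ is the Levi-Civita connection. Curvature convention: $R(X,Y)Z=\nabla_X\nabla_YZ-\nabla_Y\nabla_XZ-\nabla_{[X,Y]}Z$, the Ricci tensor is $S(X,Y)=\operatorname{trace}\{Z\mapsto R(Z,X)Y\}$, and the scalar curvature $r$ is the $g$-trace of $S$. $\mathcal{L}$ denotes the Lie derivative. *)

theory Defs
  imports "HOL-Analysis.Analysis" "HOL-Library.Function_Algebras"
begin

text \<open>Tangent vectors are real functionals on functions, so the pointwise real vector space
  structure on functions makes \<^const>\<open>dim\<close>, \<^const>\<open>span\<close> and
  \<^const>\<open>representation\<close> available for tangent spaces.\<close>

instantiation "fun" :: (type, real_vector) real_vector
begin

definition scaleR_fun :: "real \<Rightarrow> ('a \<Rightarrow> 'b) \<Rightarrow> 'a \<Rightarrow> 'b"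
  where "scaleR_fun c f = (\<lambda>x. c *\<^sub>R f x)"

instance
  by standard (simp_all add: scaleR_fun_def fun_eq_iff scaleR_add_right scaleR_add_left)

end

lemma scaleR_fun_apply [simp]: "(c *\<^sub>R f) x = c *\<^sub>R f x"
  by (simp add: scaleR_fun_def)


section \<open>Smooth manifolds\<close>

text \<open>These two notions are used on open sets \<open>S\<close> of a finite-dimensional space only; there
  continuity of all iterated directional derivatives up to order \<open>k\<close> is the class \<open>C^k\<close>.\<close>

primrec C_k_on :: "nat \<Rightarrow> 'e::real_normed_vector set \<Rightarrow> ('e \<Rightarrow> 'f::real_normed_vector) \<Rightarrow> bool"
  where
    "C_k_on 0 S f \<longleftrightarrow> continuous_on S f"
  | "C_k_on (Suc k) S f \<longleftrightarrow>
       (\<forall>x\<in>S. f differentiable (at x)) \<and>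
       (\<forall>v. C_k_on k S (\<lambda>x. frechet_derivative f (at x) v))"

definition smooth_on :: "'e::real_normed_vector set \<Rightarrow> ('e \<Rightarrow> 'f::real_normed_vector) \<Rightarrow> bool"
  where "smooth_on S f \<longleftrightarrow> (\<forall>k. C_k_on k S f)"

text \<open>A chart is a pair of its domain and its coordinate map; the latter is irrelevant outside
  the domain. An atlas need not be maximal.\<close>

type_synonym ('a, 'e) atlas = "('a set \<times> ('a \<Rightarrow> 'e)) set"

definition smooth_atlas :: "('a::topological_space, 'e::euclidean_space) atlas \<Rightarrow> bool"
  where "smooth_atlas A \<longleftrightarrow>
    (\<forall>(U, x)\<in>A. open U \<and> open (x ` U) \<and> homeomorphism U (x ` U) x (inv_into U x)) \<and>
    (\<Union>(U, x)\<in>A. U) = UNIV \<and>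
    (\<forall>(U, x)\<in>A. \<forall>(W, y)\<in>A. smooth_on (x ` (U \<inter> W)) (y \<circ> inv_into U x))"

text \<open>The manifold is the whole type \<open>'a\<close>.\<close>

definition connected_smooth_manifold ::
    "('a::{t2_space, second_countable_topology}, 'e::euclidean_space) atlas \<Rightarrow> bool"
  where "connected_smooth_manifold A \<longleftrightarrow> smooth_atlas A \<and> connected (UNIV :: 'a set)"

definition smooth_fun ::
    "('a::topological_space, 'e::euclidean_space) atlas \<Rightarrow> ('a \<Rightarrow> real) \<Rightarrow> bool"
  where "smooth_fun A f \<longleftrightarrow> (\<forall>(U, x)\<in>A. smooth_on (x ` U) (f \<circ> inv_into U x))"

text \<open>Tangent vectors at \<open>p\<close> are the derivations at \<open>p\<close> of the algebra of smooth functions.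
  They take the value 0 on non-smooth functions so that they are determined by their
  action on smooth ones.\<close>

type_synonym 'a tvector = "('a \<Rightarrow> real) \<Rightarrow> real"
type_synonym 'a vfield = "'a \<Rightarrow> 'a tvector"

definition tangent_space ::
    "('a::topological_space, 'e::euclidean_space) atlas \<Rightarrow> 'a \<Rightarrow> 'a tvector set"
  where "tangent_space A p = {v.
    (\<forall>f. \<not> smooth_fun A f \<longrightarrow> v f = 0) \<and>
    (\<forall>f h. smooth_fun A f \<longrightarrow> smooth_fun A h \<longrightarrow> v (\<lambda>q. f q + h q) = v f + v h) \<and>
    (\<forall>c f. smooth_fun A f \<longrightarrow> v (\<lambda>q. c * f q) = c * v f) \<and>
    (\<forall>f h. smooth_fun A f \<longrightarrow> smooth_fun A h \<longrightarrow>
       v (\<lambda>q. f q * h q) = f p * v h + h p * v f)}"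

definition vector_field ::
    "('a::topological_space, 'e::euclidean_space) atlas \<Rightarrow> 'a vfield \<Rightarrow> bool"
  where "vector_field A X \<longleftrightarrow>
    (\<forall>p. X p \<in> tangent_space A p) \<and>
    (\<forall>f. smooth_fun A f \<longrightarrow> smooth_fun A (\<lambda>p. X p f))"

definition lie_bracket :: "'a vfield \<Rightarrow> 'a vfield \<Rightarrow> 'a vfield"
  where "lie_bracket X Y = (\<lambda>p f. X p (\<lambda>q. Y q f) - Y p (\<lambda>q. X q f))"

definition fscale :: "('a \<Rightarrow> real) \<Rightarrow> 'a vfield \<Rightarrow> 'a vfield"
  where "fscale f X = (\<lambda>p. f p *\<^sub>R X p)"


section \<open>Tensor fields\<close>

text \<open>Tensor fields are families of multilinear maps on tangent spaces (with irrelevant values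
  elsewhere); smoothness is tested on smooth vector fields.\<close>

definition linear_map_on :: "'v::real_vector set \<Rightarrow> ('v \<Rightarrow> 'w::real_vector) \<Rightarrow> bool"
  where "linear_map_on T f \<longleftrightarrow>
    (\<forall>u\<in>T. \<forall>v\<in>T. f (u + v) = f u + f v) \<and> (\<forall>c. \<forall>v\<in>T. f (c *\<^sub>R v) = c *\<^sub>R f v)"

type_synonym 'a endo_field = "'a \<Rightarrow> 'a tvector \<Rightarrow> 'a tvector"
type_synonym 'a one_form = "'a \<Rightarrow> 'a tvector \<Rightarrow> real"
type_synonym 'a bilinear_field = "'a \<Rightarrow> 'a tvector \<Rightarrow> 'a tvector \<Rightarrow> real"

definition endo_field ::
    "('a::topological_space, 'e::euclidean_space) atlas \<Rightarrow> 'a endo_field \<Rightarrow> bool"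
  where "endo_field A \<phi> \<longleftrightarrow>
    (\<forall>p. linear_map_on (tangent_space A p) (\<phi> p) \<and>
         \<phi> p ` tangent_space A p \<subseteq> tangent_space A p) \<and>
    (\<forall>X. vector_field A X \<longrightarrow> vector_field A (\<lambda>p. \<phi> p (X p)))"

definition one_form ::
    "('a::topological_space, 'e::euclidean_space) atlas \<Rightarrow> 'a one_form \<Rightarrow> bool"
  where "one_form A \<eta> \<longleftrightarrow>
    (\<forall>p. linear_map_on (tangent_space A p) (\<eta> p)) \<and>
    (\<forall>X. vector_field A X \<longrightarrow> smooth_fun A (\<lambda>p. \<eta> p (X p)))"

text \<open>The index of a nondegenerate symmetric smooth field is locally constant, hence constant on a
  connected manifold; it is therefore not mentioned.\<close>

definition semi_riemannian_metric ::
    "('a::topological_space, 'e::euclidean_space) atlas \<Rightarrow> 'a bilinear_field \<Rightarrow> bool"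
  where "semi_riemannian_metric A g \<longleftrightarrow>
    (\<forall>p. \<forall>u\<in>tangent_space A p. linear_map_on (tangent_space A p) (g p u)) \<and>
    (\<forall>p. \<forall>u\<in>tangent_space A p. \<forall>v\<in>tangent_space A p. g p u v = g p v u) \<and>
    (\<forall>p. \<forall>u\<in>tangent_space A p. (\<forall>v\<in>tangent_space A p. g p u v = 0) \<longrightarrow> u = 0) \<and>
    (\<forall>X Y. vector_field A X \<longrightarrow> vector_field A Y \<longrightarrow> smooth_fun A (\<lambda>p. g p (X p) (Y p)))"

text \<open>Convention with the factor 1/2: \<open>2 d\<eta>(X,Y) = X \<eta>(Y) - Y \<eta>(X) - \<eta>([X,Y])\<close>.\<close>

definition ext_deriv :: "'a one_form \<Rightarrow> 'a vfield \<Rightarrow> 'a vfield \<Rightarrow> 'a \<Rightarrow> real"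
  where "ext_deriv \<eta> X Y = (\<lambda>p.
    (X p (\<lambda>q. \<eta> q (Y q)) - Y p (\<lambda>q. \<eta> q (X q)) - \<eta> p (lie_bracket X Y p)) / 2)"

definition lie_deriv :: "'a vfield \<Rightarrow> 'a bilinear_field \<Rightarrow> 'a vfield \<Rightarrow> 'a vfield \<Rightarrow> 'a \<Rightarrow> real"
  where "lie_deriv V g X Y = (\<lambda>p.
    V p (\<lambda>q. g q (X q) (Y q)) - g p (lie_bracket V X p) (Y p) - g p (X p) (lie_bracket V Y p))"


section \<open>Levi-Civita connection and curvature\<close>

definition affine_connection ::
    "('a::topological_space, 'e::euclidean_space) atlas \<Rightarrow>
     ('a vfield \<Rightarrow> 'a vfield \<Rightarrow> 'a vfield) \<Rightarrow> bool"
  where "affine_connection A D \<longleftrightarrow>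
    (\<forall>X Y. vector_field A X \<longrightarrow> vector_field A Y \<longrightarrow> vector_field A (D X Y)) \<and>
    (\<forall>X Y Z. vector_field A X \<longrightarrow> vector_field A Y \<longrightarrow> vector_field A Z \<longrightarrow>
       D (X + Y) Z = D X Z + D Y Z \<and> D X (Y + Z) = D X Y + D X Z) \<and>
    (\<forall>f X Y. smooth_fun A f \<longrightarrow> vector_field A X \<longrightarrow> vector_field A Y \<longrightarrow>
       D (fscale f X) Y = fscale f (D X Y) \<and>
       D X (fscale f Y) = fscale (\<lambda>p. X p f) Y + fscale f (D X Y))"

definition is_levi_civita ::
    "('a::topological_space, 'e::euclidean_space) atlas \<Rightarrow> 'a bilinear_field \<Rightarrow>
     ('a vfield \<Rightarrow> 'a vfield \<Rightarrow> 'a vfield) \<Rightarrow> bool"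
  where "is_levi_civita A g D \<longleftrightarrow> affine_connection A D \<and>
    (\<forall>X Y. vector_field A X \<longrightarrow> vector_field A Y \<longrightarrow> D X Y - D Y X = lie_bracket X Y) \<and>
    (\<forall>X Y Z p. vector_field A X \<longrightarrow> vector_field A Y \<longrightarrow> vector_field A Z \<longrightarrow>
       X p (\<lambda>q. g q (Y q) (Z q)) = g p (D X Y p) (Z p) + g p (Y p) (D X Z p))"

text \<open>Existence, and uniqueness on smooth vector fields, is the fundamental theorem of
  semi-Riemannian geometry; only the irrelevant values on other arguments depend on the choice.\<close>

definition levi_civita ::
    "('a::topological_space, 'e::euclidean_space) atlas \<Rightarrow> 'a bilinear_field \<Rightarrow>
     'a vfield \<Rightarrow> 'a vfield \<Rightarrow> 'a vfield"
  where "levi_civita A g = (SOME D. is_levi_civita A g D)"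

definition curvature_field ::
    "('a vfield \<Rightarrow> 'a vfield \<Rightarrow> 'a vfield) \<Rightarrow> 'a vfield \<Rightarrow> 'a vfield \<Rightarrow> 'a vfield \<Rightarrow> 'a vfield"
  where "curvature_field D X Y Z =
    D X (D Y Z) - D Y (D X Z) - D (lie_bracket X Y) Z"

text \<open>By tensoriality the value at \<open>p\<close> does not depend on the extensions of the three tangent
  vectors to vector fields.\<close>

definition extend_vector ::
    "('a::topological_space, 'e::euclidean_space) atlas \<Rightarrow> 'a \<Rightarrow> 'a tvector \<Rightarrow> 'a vfield"
  where "extend_vector A p v = (SOME X. vector_field A X \<and> X p = v)"

definition curvature ::
    "('a::topological_space, 'e::euclidean_space) atlas \<Rightarrow> 'a bilinear_field \<Rightarrow> 'a \<Rightarrow>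
     'a tvector \<Rightarrow> 'a tvector \<Rightarrow> 'a tvector \<Rightarrow> 'a tvector"
  where "curvature A g p u v w = curvature_field (levi_civita A g)
    (extend_vector A p u) (extend_vector A p v) (extend_vector A p w) p"

text \<open>Trace of a linear endomorphism of a finite-dimensional subspace \<open>T\<close>, by means of an arbitrary
  basis.\<close>

definition endo_trace :: "'v::real_vector set \<Rightarrow> ('v \<Rightarrow> 'v) \<Rightarrow> real"
  where "endo_trace T f =
    (let B = (SOME B. independent B \<and> span B = T) in \<Sum>b\<in>B. representation B (f b) b)"

definition ricci ::
    "('a::topological_space, 'e::euclidean_space) atlas \<Rightarrow> 'a bilinear_field \<Rightarrow> 'a bilinear_field"
  where "ricci A g p u v = endo_trace (tangent_space A p) (\<lambda>z. curvature A g p z u v)"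

text \<open>The trace of a bilinear form \<open>S\<close> with respect to \<open>g\<close> is the trace of the endomorphism \<open>Q\<close> with
  \<open>g(Qu,v) = S(u,v)\<close>.\<close>

definition metric_trace ::
    "('a::topological_space, 'e::euclidean_space) atlas \<Rightarrow> 'a bilinear_field \<Rightarrow>
     'a bilinear_field \<Rightarrow> 'a \<Rightarrow> real"
  where "metric_trace A g S p = endo_trace (tangent_space A p)
    (\<lambda>u. THE w. w \<in> tangent_space A p \<and> (\<forall>v\<in>tangent_space A p. g p w v = S p u v))"

definition scalar_curvature ::
    "('a::topological_space, 'e::euclidean_space) atlas \<Rightarrow> 'a bilinear_field \<Rightarrow> 'a \<Rightarrow> real"
  where "scalar_curvature A g = metric_trace A g (ricci A g)"


section \<open>Para-Sasakian manifolds\<close>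

definition almost_paracontact ::
    "('a::topological_space, 'e::euclidean_space) atlas \<Rightarrow>
     'a endo_field \<Rightarrow> 'a vfield \<Rightarrow> 'a one_form \<Rightarrow> bool"
  where "almost_paracontact A \<phi> \<xi> \<eta> \<longleftrightarrow>
    endo_field A \<phi> \<and> vector_field A \<xi> \<and> one_form A \<eta> \<and>
    (\<forall>p. \<eta> p (\<xi> p) = 1) \<and>
    (\<forall>p. \<forall>v\<in>tangent_space A p. \<phi> p (\<phi> p v) = v - \<eta> p v *\<^sub>R \<xi> p) \<and>
    (\<exists>n. DIM('e) = 2 * n + 1 \<and>
      (\<forall>p. dim {v \<in> tangent_space A p. \<eta> p v = 0 \<and> \<phi> p v = v} = n \<and>
           dim {v \<in> tangent_space A p. \<eta> p v = 0 \<and> \<phi> p v = - v} = n))"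

definition almost_paracontact_metric ::
    "('a::topological_space, 'e::euclidean_space) atlas \<Rightarrow>
     'a endo_field \<Rightarrow> 'a vfield \<Rightarrow> 'a one_form \<Rightarrow> 'a bilinear_field \<Rightarrow> bool"
  where "almost_paracontact_metric A \<phi> \<xi> \<eta> g \<longleftrightarrow>
    almost_paracontact A \<phi> \<xi> \<eta> \<and> semi_riemannian_metric A g \<and>
    (\<forall>p. \<forall>u\<in>tangent_space A p. \<forall>v\<in>tangent_space A p.
       g p (\<phi> p u) (\<phi> p v) = - g p u v + \<eta> p u * \<eta> p v)"

definition fundamental_form :: "'a endo_field \<Rightarrow> 'a bilinear_field \<Rightarrow> 'a bilinear_field"
  where "fundamental_form \<phi> g p u v = g p u (\<phi> p v)"

definition nijenhuis :: "'a endo_field \<Rightarrow> 'a vfield \<Rightarrow> 'a vfield \<Rightarrow> 'a vfield"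
  where "nijenhuis \<phi> X Y = (\<lambda>p.
    \<phi> p (\<phi> p (lie_bracket X Y p))
    + lie_bracket (\<lambda>q. \<phi> q (X q)) (\<lambda>q. \<phi> q (Y q)) p
    - \<phi> p (lie_bracket (\<lambda>q. \<phi> q (X q)) Y p)
    - \<phi> p (lie_bracket X (\<lambda>q. \<phi> q (Y q)) p))"

definition normal_structure ::
    "('a::topological_space, 'e::euclidean_space) atlas \<Rightarrow>
     'a endo_field \<Rightarrow> 'a vfield \<Rightarrow> 'a one_form \<Rightarrow> bool"
  where "normal_structure A \<phi> \<xi> \<eta> \<longleftrightarrow>
    (\<forall>X Y p. vector_field A X \<longrightarrow> vector_field A Y \<longrightarrow>
       nijenhuis \<phi> X Y p - (2 * ext_deriv \<eta> X Y p) *\<^sub>R \<xi> p = 0)"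

definition paracontact_metric ::
    "('a::topological_space, 'e::euclidean_space) atlas \<Rightarrow>
     'a endo_field \<Rightarrow> 'a vfield \<Rightarrow> 'a one_form \<Rightarrow> 'a bilinear_field \<Rightarrow> bool"
  where "paracontact_metric A \<phi> \<xi> \<eta> g \<longleftrightarrow>
    almost_paracontact_metric A \<phi> \<xi> \<eta> g \<and>
    (\<forall>X Y p. vector_field A X \<longrightarrow> vector_field A Y \<longrightarrow>
       ext_deriv \<eta> X Y p = fundamental_form \<phi> g p (X p) (Y p))"

definition para_sasakian ::
    "('a::{t2_space, second_countable_topology}, 'e::euclidean_space) atlas \<Rightarrow>
     'a endo_field \<Rightarrow> 'a vfield \<Rightarrow> 'a one_form \<Rightarrow> 'a bilinear_field \<Rightarrow> bool"
  where "para_sasakian A \<phi> \<xi> \<eta> g \<longleftrightarrow>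
    connected_smooth_manifold A \<and> paracontact_metric A \<phi> \<xi> \<eta> g \<and> normal_structure A \<phi> \<xi> \<eta>"

definition yamabe_soliton ::
    "('a::topological_space, 'e::euclidean_space) atlas \<Rightarrow>
     'a bilinear_field \<Rightarrow> 'a vfield \<Rightarrow> real \<Rightarrow> bool"
  where "yamabe_soliton A g V l \<longleftrightarrow> vector_field A V \<and>
    (\<forall>X Y p. vector_field A X \<longrightarrow> vector_field A Y \<longrightarrow>
       lie_deriv V g X Y p = (l - scalar_curvature A g p) * g p (X p) (Y p))"

end

theory Submission
  imports Defs
begin

text \<open>Since \<open>(L\<^sub>\<xi> g)(X, \<xi>) = 2 d\<eta>(\<xi>, X) = 0\<close>, the soliton equation evaluated at
  \<open>(X, \<xi>)\<close> reads \<open>X b + (\<xi> b) \<eta>(X) = (\<lambda> - r) \<eta>(X)\<close>. Taking \<open>X = \<xi>\<close> gives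
  \<open>\<lambda> - r = 2 \<xi> b\<close>, so \<open>db = (\<xi> b) \<eta>\<close>. Horizontal fields \<open>X\<close>, \<open>Y\<close> therefore annihilate \<open>b\<close>,
  and so does \<open>[X, Y]\<close>; as \<open>\<eta>([X, Y]) = - 2 d\<eta>(X, Y) = - 2 g(X, \<phi> Y)\<close> is nonzero for suitable
  \<open>X\<close> and \<open>Y\<close>, it follows that \<open>\<xi> b = 0\<close> and hence \<open>db = 0\<close>. Bump functions supply enough global vector fields.\<close>


subsection \<open>Calculus of smooth maps\<close>

text \<open>A derivative at a point of the open set \<open>S\<close> depends only on nearby values,
  so agreement on \<open>S\<close> passes to all derivatives. The induction varies both functions
  because it continues with their derivatives.\<close>

lemma C_k_on_cong:
  assumes "open S" "\<And>x. x \<in> S \<Longrightarrow> f x = g x"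
  shows "C_k_on k S f \<longleftrightarrow> C_k_on k S g"
  using assms(2)
proof (induction k arbitrary: f g)
  case 0
  then show ?case by (simp cong: continuous_on_cong)
next
  case (Suc k)
  have der: "(f has_derivative D) (at x) \<longleftrightarrow> (g has_derivative D) (at x)" if "x \<in> S" for x D
    using has_derivative_transform_within_open[OF _ assms(1) that] Suc.prems by metis
  have "f differentiable (at x) \<longleftrightarrow> g differentiable (at x)" if "x \<in> S" for x
    using der[OF that] by (simp add: differentiable_def)
  moreover have "C_k_on k S (\<lambda>x. frechet_derivative f (at x) v) \<longleftrightarrow>
                 C_k_on k S (\<lambda>x. frechet_derivative g (at x) v)" for v
    by (rule Suc.IH) (simp add: frechet_derivative_def der)
  ultimately show ?case by simp
qed

text \<open>\<open>C_k_on\<close> is stated with the chosen operator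
  \<open>frechet_derivative\<close>; uniqueness of derivatives allows any explicit formula
  \<open>f'\<close> in its place.\<close>

lemma C_k_on_SucI:
  assumes "open S" "\<And>x. x \<in> S \<Longrightarrow> (f has_derivative f' x) (at x)"
    and "\<And>v. C_k_on k S (\<lambda>x. f' x v)"
  shows "C_k_on (Suc k) S f"
proof -
  have "C_k_on k S (\<lambda>x. frechet_derivative f (at x) v)" for v
    using assms(3)[of v]
    by (subst C_k_on_cong[OF assms(1), where g = "\<lambda>x. f' x v"])
      (metis assms(2) frechet_derivative_at)
  then show ?thesis
    using assms(2) by (auto simp: differentiable_def)
qed

lemma C_k_on_SucD:
  assumes "C_k_on (Suc k) S f"
  shows "\<And>x. x \<in> S \<Longrightarrow> (f has_derivative frechet_derivative f (at x)) (at x)"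
    and "C_k_on k S (\<lambda>x. frechet_derivative f (at x) v)"
  using assms by (auto simp: frechet_derivative_works[symmetric])

lemma C_k_on_Suc_imp: "C_k_on (Suc k) S f \<Longrightarrow> C_k_on k S f"
proof (induction k arbitrary: f)
  case 0
  then show ?case
    by (auto intro!: continuous_at_imp_continuous_on differentiable_imp_continuous_within)
next
  case (Suc k)
  then show ?case by (metis C_k_on.simps(2))
qed

lemma C_k_on_subset: "C_k_on k S f \<Longrightarrow> T \<subseteq> S \<Longrightarrow> C_k_on k T f"
  by (induction k arbitrary: f) (auto intro: continuous_on_subset)

text \<open>Continuity glues over open sets, and differentiability is required \<open>at x\<close>
  rather than within the piece, so it is the same pointwise condition on every piece.\<close>

lemma C_k_on_Union:
  assumes "\<And>T. T \<in> \<T> \<Longrightarrow> open T" "\<And>T. T \<in> \<T> \<Longrightarrow> C_k_on k T f"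
  shows "C_k_on k (\<Union>\<T>) f"
  using assms(2)
  by (induction k arbitrary: f) (use assms(1) in \<open>auto intro: continuous_on_open_Union\<close>)

lemma C_k_on_const: "open S \<Longrightarrow> C_k_on k S (\<lambda>x. c)"
proof (induction k arbitrary: c)
  case (Suc k)
  then show ?case by (intro C_k_on_SucI) (auto intro!: derivative_eq_intros)
qed simp

lemma C_k_on_bounded_linear:
  assumes "bounded_linear L" "open S"
  shows "C_k_on k S L"
proof (cases k)
  case 0
  then show ?thesis by (simp add: assms(1) linear_continuous_on)
next
  case (Suc j)
  show ?thesis unfolding Suc
    using assms by (intro C_k_on_SucI[where f' = "\<lambda>_. L"])
      (auto intro: bounded_linear_imp_has_derivative C_k_on_const)
qed

lemma C_k_on_bounded_linear_compose:
  assumes "bounded_linear L" "open S"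
  shows "C_k_on k S f \<Longrightarrow> C_k_on k S (\<lambda>x. L (f x))"
proof (induction k arbitrary: f)
  case 0
  then show ?case
    using assms(1) by (auto intro: bounded_linear.continuous_on)
next
  case (Suc k)
  show ?case
    by (rule C_k_on_SucI[OF assms(2) bounded_linear.has_derivative[OF assms(1) C_k_on_SucD(1)[OF Suc.prems]]])
      (auto intro: Suc.IH C_k_on_SucD(2)[OF Suc.prems])
qed

lemma C_k_on_add:
  assumes "open S"
  shows "C_k_on k S f \<Longrightarrow> C_k_on k S g \<Longrightarrow> C_k_on k S (\<lambda>x. f x + g x)"
proof (induction k arbitrary: f g)
  case 0
  then show ?case by (auto intro: continuous_intros)
next
  case (Suc k)
  show ?case
    by (rule C_k_on_SucI[OF assms, where
        f' = "\<lambda>x v. frechet_derivative f (at x) v + frechet_derivative g (at x) v"])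
      (use C_k_on_SucD[OF Suc.prems(1)] C_k_on_SucD[OF Suc.prems(2)] Suc.IH in
        \<open>auto intro: has_derivative_add\<close>)
qed

lemma C_k_on_sum:
  assumes "open S" "\<And>i. i \<in> I \<Longrightarrow> C_k_on k S (f i)"
  shows "C_k_on k S (\<lambda>x. \<Sum>i\<in>I. f i x)"
  using assms(2)
  by (induction I rule: infinite_finite_induct)
    (auto intro: C_k_on_const C_k_on_add assms(1))

lemma C_k_on_scaleR:
  assumes "open S"
  shows "C_k_on k S f \<Longrightarrow> C_k_on k S g \<Longrightarrow> C_k_on k S (\<lambda>x. f x *\<^sub>R g x)"
proof (induction k arbitrary: f g)
  case 0
  then show ?case by (auto intro: continuous_intros)
next
  case (Suc k)
  show ?case
  proof (rule C_k_on_SucI[OF assms])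
    fix x assume "x \<in> S"
    then show "((\<lambda>x. f x *\<^sub>R g x) has_derivative
        (\<lambda>v. f x *\<^sub>R frechet_derivative g (at x) v + frechet_derivative f (at x) v *\<^sub>R g x)) (at x)"
      by (intro has_derivative_scaleR C_k_on_SucD(1)[OF Suc.prems(1)] C_k_on_SucD(1)[OF Suc.prems(2)])
  next
    fix v
    \<comment> \<open>The product rule leaves one factor undifferentiated; it has to be lowered from
      level \<open>Suc k\<close> to \<open>k\<close> before the induction hypothesis
      applies.\<close>
    show "C_k_on k S (\<lambda>x. f x *\<^sub>R frechet_derivative g (at x) v + frechet_derivative f (at x) v *\<^sub>R g x)"
      by (intro C_k_on_add[OF assms] Suc.IH C_k_on_SucD(2)[OF Suc.prems(1)]
          C_k_on_SucD(2)[OF Suc.prems(2)] C_k_on_Suc_imp[OF Suc.prems(1)] C_k_on_Suc_imp[OF Suc.prems(2)])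
  qed
qed

lemma C_k_on_compose:
  fixes h :: "'e::real_normed_vector \<Rightarrow> 'f::euclidean_space"
    and f :: "'f \<Rightarrow> 'g::real_normed_vector"
  assumes "open S" "open T" "h ` S \<subseteq> T"
  shows "C_k_on k T f \<Longrightarrow> C_k_on k S h \<Longrightarrow> C_k_on k S (\<lambda>x. f (h x))"
proof (induction k arbitrary: f)
  case 0
  then show ?case
    using assms(3) by (auto intro: continuous_on_compose2)
next
  case (Suc k)
  let ?f = "\<lambda>y. frechet_derivative f (at y)" and ?h = "\<lambda>x. frechet_derivative h (at x)"
  show ?case
  proof (rule C_k_on_SucI[OF assms(1)])
    fix x assume x: "x \<in> S"
    have "(f has_derivative ?f (h x)) (at (h x))"
      using C_k_on_SucD(1)[OF Suc.prems(1)] x assms(3) by auto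
    then have comp: "((\<lambda>x. f (h x)) has_derivative (\<lambda>v. ?f (h x) (?h x v))) (at x)"
      by (rule has_derivative_compose[OF C_k_on_SucD(1)[OF Suc.prems(2) x]])
    have lin: "linear (?f (h x))"
      using \<open>(f has_derivative ?f (h x)) (at (h x))\<close> has_derivative_linear by blast
    \<comment> \<open>The direction \<open>?h x v\<close> varies with \<open>x\<close>, whereas the
      induction hypothesis concerns derivatives of \<open>f\<close> in a fixed direction. Expanding
      in the basis leaves fixed directions \<open>i\<close> with coefficients depending on
      \<open>x\<close>; this is where the middle space has to be Euclidean.\<close>
    have "?f (h x) (?h x v) = (\<Sum>i\<in>Basis. (?h x v \<bullet> i) *\<^sub>R ?f (h x) i)" for v
      by (subst euclidean_representation[of "?h x v", symmetric])
        (simp add: linear_sum[OF lin] linear_scale[OF lin])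
    then show "((\<lambda>x. f (h x)) has_derivative (\<lambda>v. \<Sum>i\<in>Basis. (?h x v \<bullet> i) *\<^sub>R ?f (h x) i)) (at x)"
      using comp by simp
  next
    fix v
    show "C_k_on k S (\<lambda>x. \<Sum>i\<in>Basis. (?h x v \<bullet> i) *\<^sub>R ?f (h x) i)"
      by (intro C_k_on_sum C_k_on_scaleR assms(1) Suc.IH C_k_on_SucD(2)[OF Suc.prems(1)]
          C_k_on_Suc_imp[OF Suc.prems(2)]
          C_k_on_bounded_linear_compose[OF bounded_linear_inner_left assms(1)]
          C_k_on_SucD(2)[OF Suc.prems(2)])
  qed
qed

section \<open>Passage from finite order to smooth maps\<close>

lemma smooth_on_cong: "open S \<Longrightarrow> (\<And>x. x \<in> S \<Longrightarrow> f x = g x) \<Longrightarrow> smooth_on S f \<longleftrightarrow> smooth_on S g"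
  by (simp add: smooth_on_def C_k_on_cong[of S f g])

lemma smooth_on_subset: "smooth_on S f \<Longrightarrow> T \<subseteq> S \<Longrightarrow> smooth_on T f"
  by (auto simp: smooth_on_def intro: C_k_on_subset)

lemma smooth_on_Un: "open S \<Longrightarrow> open T \<Longrightarrow> smooth_on S f \<Longrightarrow> smooth_on T f \<Longrightarrow> smooth_on (S \<union> T) f"
  using C_k_on_Union[of "{S, T}"] by (auto simp: smooth_on_def)

lemma smooth_on_const: "open S \<Longrightarrow> smooth_on S (\<lambda>x. c)"
  by (simp add: smooth_on_def C_k_on_const)

lemma smooth_on_bounded_linear: "bounded_linear L \<Longrightarrow> open S \<Longrightarrow> smooth_on S L"
  by (simp add: smooth_on_def C_k_on_bounded_linear)

lemma smooth_on_add:
  "open S \<Longrightarrow> smooth_on S f \<Longrightarrow> smooth_on S g \<Longrightarrow> smooth_on S (\<lambda>x. f x + g x)"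
  by (simp add: smooth_on_def C_k_on_add)

lemma smooth_on_mult:
  fixes f g :: "'e::real_normed_vector \<Rightarrow> real"
  shows "open S \<Longrightarrow> smooth_on S f \<Longrightarrow> smooth_on S g \<Longrightarrow> smooth_on S (\<lambda>x. f x * g x)"
  using C_k_on_scaleR[of S _ f g] by (simp add: smooth_on_def)

lemma smooth_on_sum:
  "open S \<Longrightarrow> (\<And>i. i \<in> I \<Longrightarrow> smooth_on S (f i)) \<Longrightarrow> smooth_on S (\<lambda>x. \<Sum>i\<in>I. f i x)"
  by (simp add: smooth_on_def C_k_on_sum)

lemma smooth_on_compose:
  fixes h :: "'e::real_normed_vector \<Rightarrow> 'f::euclidean_space"
  shows "open S \<Longrightarrow> open T \<Longrightarrow> h ` S \<subseteq> T \<Longrightarrow> smooth_on T f \<Longrightarrow> smooth_on S h \<Longrightarrow>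
    smooth_on S (\<lambda>x. f (h x))"
  by (simp add: smooth_on_def C_k_on_compose)

lemma smooth_on_has_derivative:
  "smooth_on S f \<Longrightarrow> x \<in> S \<Longrightarrow> (f has_derivative frechet_derivative f (at x)) (at x)"
  unfolding smooth_on_def by (metis C_k_on_SucD(1))

lemma smooth_on_frechet_derivative:
  "smooth_on S f \<Longrightarrow> smooth_on S (\<lambda>x. frechet_derivative f (at x) v)"
  unfolding smooth_on_def by (metis C_k_on_SucD(2))


subsection \<open>Bump functions\<close>

text \<open>This family is closed under differentiation, which gives smoothness by induction.\<close>

definition exp_bump :: "real poly \<Rightarrow> real \<Rightarrow> real"
  where "exp_bump P t = (if t > 0 then poly P (1 / t) * exp (- (1 / t)) else 0)"

text \<open>The substitution \<open>s = 1 / t\<close> reduces this to the decay of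
  \<open>s ^ i * exp (- s)\<close> at infinity, monomial by monomial.\<close>

lemma poly_exp_tendsto_0: "((\<lambda>t. poly P (1 / t) * exp (- (1 / t))) \<longlongrightarrow> 0) (at_right (0::real))"
proof -
  have "((\<lambda>s. poly P s * exp (- s)) \<longlongrightarrow> 0) at_top"
  proof (induction P)
    case (pCons a P)
    have "((\<lambda>s. s ^ i * exp (- s)) \<longlongrightarrow> (0::real)) at_top" for i
      using tendsto_power_div_exp_0[of i] by (simp add: exp_minus divide_inverse)
    then have "((\<lambda>s. \<Sum>i\<le>degree (pCons a P). coeff (pCons a P) i * (s ^ i * exp (- s))) \<longlongrightarrow>
        (\<Sum>i\<le>degree (pCons a P). coeff (pCons a P) i * 0)) at_top"
      by (intro tendsto_intros)
    then show ?case
      by (simp add: poly_altdef sum_distrib_right mult.assoc)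
  qed simp
  then have "((\<lambda>t. poly P (inverse t) * exp (- inverse t)) \<longlongrightarrow> 0) (at_right (0::real))"
    by (rule filterlim_compose[OF _ filterlim_inverse_at_top_right])
  then show ?thesis
    by (simp add: divide_inverse)
qed

text \<open>With \<open>s = 1 / t\<close> the derivative for positive \<open>t\<close> is
  \<open>s^2 (P(s) - P'(s)) exp (- s)\<close>, and \<open>[:0, 0, 1:]\<close> is the polynomial
  \<open>s^2\<close>.\<close>

lemma exp_bump_has_derivative:
  "(exp_bump P has_real_derivative exp_bump ([:0, 0, 1:] * (P - pderiv P)) t) (at t)"
proof -
  consider "t > 0" | "t < 0" | "t = 0" by linarith
  then show ?thesis
  proof cases
    case 1
    have "((\<lambda>t. poly P (1 / t) * exp (- (1 / t))) has_real_derivative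
        exp_bump ([:0, 0, 1:] * (P - pderiv P)) t) (at t)"
      using 1 by (auto intro!: derivative_eq_intros simp: exp_bump_def field_simps power2_eq_square)
    then show ?thesis
      by (rule has_field_derivative_transform_within_open[where S = "{0<..}"])
        (use 1 in \<open>auto simp: exp_bump_def\<close>)
  next
    case 2
    have "((\<lambda>t. 0) has_real_derivative exp_bump ([:0, 0, 1:] * (P - pderiv P)) t) (at t)"
      using 2 by (auto simp: exp_bump_def)
    then show ?thesis
      by (rule has_field_derivative_transform_within_open[where S = "{..<0}"])
        (use 2 in \<open>auto simp: exp_bump_def\<close>)
  next
    case 3
    have "((\<lambda>h. (exp_bump P (0 + h) - exp_bump P 0) / h) \<longlongrightarrow> 0) (at 0)"
    proof (subst filterlim_at_split, intro conjI)
      have "eventually (\<lambda>h. 0 = (exp_bump P (0 + h) - exp_bump P 0) / h) (at_left 0)"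
        by (auto simp: eventually_at_left_field exp_bump_def intro!: exI[of _ "-1"])
      then show "((\<lambda>h. (exp_bump P (0 + h) - exp_bump P 0) / h) \<longlongrightarrow> 0) (at_left 0)"
        by (rule Lim_transform_eventually[OF tendsto_const])
      \<comment> \<open>The factor \<open>1 / h\<close> of the difference quotient is absorbed into
        the polynomial, so the preceding limit applies again.\<close>
      have "eventually (\<lambda>h. poly ([:0, 1:] * P) (1 / h) * exp (- (1 / h)) =
          (exp_bump P (0 + h) - exp_bump P 0) / h) (at_right 0)"
        by (auto simp: eventually_at_right_field exp_bump_def intro!: exI[of _ 1])
      then show "((\<lambda>h. (exp_bump P (0 + h) - exp_bump P 0) / h) \<longlongrightarrow> 0) (at_right 0)"
        by (rule Lim_transform_eventually[OF poly_exp_tendsto_0])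
    qed
    then show ?thesis
      using 3 by (simp add: DERIV_def exp_bump_def)
  qed
qed

lemma smooth_on_exp_bump: "smooth_on UNIV (exp_bump P)"
proof -
  \<comment> \<open>Differentiating in direction \<open>v\<close> produces a factor
    \<open>v\<close>, so the induction carries an arbitrary constant \<open>c\<close> along with an
    arbitrary \<open>P\<close>.\<close>
  have "C_k_on k UNIV (\<lambda>t. c * exp_bump P t)" for k c
  proof (induction k arbitrary: c P)
    case 0
    have "isCont (exp_bump P) t" for t
      using exp_bump_has_derivative DERIV_isCont by blast
    then show ?case
      by (auto intro!: continuous_at_imp_continuous_on continuous_intros)
  next
    case (Suc k)
    let ?Q = "[:0, 0, 1:] * (P - pderiv P)"
    have "((\<lambda>t. c * exp_bump P t) has_derivative (\<lambda>v. (v * c) * exp_bump ?Q t)) (at t)" for t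
      using has_derivative_mult_right[OF exp_bump_has_derivative[of P t, unfolded has_field_derivative_def], of c]
      by (rule has_derivative_eq_rhs) (simp only: fun_eq_iff ac_simps simp_thms)
    then show ?case
      using Suc.IH by (intro C_k_on_SucI) auto
  qed
  from this[of _ 1] show ?thesis by (simp add: smooth_on_def)
qed

lemma smooth_bump_exists:
  fixes a :: "'e::euclidean_space"
  assumes "r > 0"
  obtains \<beta> :: "'e \<Rightarrow> real"
  where "smooth_on UNIV \<beta>" "\<beta> a \<noteq> 0" "\<And>z. z \<notin> cball a r \<Longrightarrow> \<beta> z = 0"
proof
  \<comment> \<open>The argument is \<open>r^2 - |z - a|^2\<close>, positive exactly on the open
    ball, and the polynomial 1 gives the classical \<open>exp (- 1 / t)\<close>. In coordinates the
    squared distance is visibly built from smooth sums and products.\<close>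
  define \<beta> where "\<beta> z = exp_bump 1 (r\<^sup>2 + (\<Sum>i\<in>Basis. - (((z - a) \<bullet> i) * ((z - a) \<bullet> i))))" for z
  have "smooth_on UNIV (\<lambda>z. (z - a) \<bullet> i)" for i
    using smooth_on_add[OF open_UNIV smooth_on_bounded_linear[OF bounded_linear_inner_left[of i]]
        smooth_on_const[of _ "- a \<bullet> i"]]
    by (simp add: inner_diff_left)
  then have "smooth_on UNIV (\<lambda>z. (-1) * (((z - a) \<bullet> i) * ((z - a) \<bullet> i)))" for i
    by (intro smooth_on_mult smooth_on_const open_UNIV)
  then have "smooth_on UNIV (\<lambda>z. r\<^sup>2 + (\<Sum>i\<in>Basis. - (((z - a) \<bullet> i) * ((z - a) \<bullet> i))))"
    by (intro smooth_on_add smooth_on_sum smooth_on_const open_UNIV) simp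
  then show "smooth_on UNIV \<beta>"
    unfolding \<beta>_def by (intro smooth_on_compose[OF open_UNIV open_UNIV _ smooth_on_exp_bump]) auto
  have eq: "\<beta> z = exp_bump 1 (r\<^sup>2 - (dist a z)\<^sup>2)" for z
  proof -
    have "(dist a z)\<^sup>2 = (\<Sum>i\<in>Basis. ((z - a) \<bullet> i) * ((z - a) \<bullet> i))"
      by (simp add: dist_norm norm_minus_commute[of a] power2_norm_eq_inner euclidean_inner[of "z - a" "z - a"]
          del: inner_diff_left)
    then show ?thesis by (simp add: \<beta>_def sum_negf)
  qed
  show "\<beta> a \<noteq> 0"
    using assms by (simp add: eq exp_bump_def)
  show "\<beta> z = 0" if "z \<notin> cball a r" for z
  proof -
    have "r\<^sup>2 < (dist a z)\<^sup>2"
      using that assms by (intro power_strict_mono) auto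
    then show ?thesis by (simp add: eq exp_bump_def)
  qed
qed


subsection \<open>Charts and smooth functions\<close>

lemma smooth_atlasD:
  assumes "smooth_atlas A" "(U, x) \<in> A"
  shows "open U" "open (x ` U)" "homeomorphism U (x ` U) x (inv_into U x)" "inj_on x U"
proof -
  show "open U" "open (x ` U)" and h: "homeomorphism U (x ` U) x (inv_into U x)"
    using assms by (auto simp: smooth_atlas_def)
  show "inj_on x U"
    by (rule inj_on_inverseI[where g = "inv_into U x"]) (use h in \<open>auto simp: homeomorphism_def\<close>)
qed

lemma smooth_atlas_transition:
  assumes "smooth_atlas A" "(U, x) \<in> A" "(W, y) \<in> A"
  shows "smooth_on (x ` (U \<inter> W)) (y \<circ> inv_into U x)"
  using assms by (auto simp: smooth_atlas_def)

lemma smooth_atlas_cover: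
  assumes "smooth_atlas A"
  obtains U x where "(U, x) \<in> A" "p \<in> U"
proof -
  have "p \<in> (\<Union>(U, x)\<in>A. U)"
    using assms by (simp add: smooth_atlas_def)
  then show ?thesis using that by blast
qed

lemma chart_image_open:
  assumes "smooth_atlas A" "(U, x) \<in> A" "open W"
  shows "open (x ` (U \<inter> W))"
proof -
  note D = smooth_atlasD[OF assms(1,2)]
  have "x ` (U \<inter> W) = x ` U \<inter> inv_into U x -` W"
    using D(4) by auto
  moreover have "continuous_on (x ` U) (inv_into U x)"
    using D(3) by (simp add: homeomorphism_def)
  ultimately show ?thesis
    using continuous_open_preimage D(2) assms(3) by metis
qed

lemma smooth_funD: "smooth_fun A f \<Longrightarrow> (U, x) \<in> A \<Longrightarrow> smooth_on (x ` U) (f \<circ> inv_into U x)"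
  by (auto simp: smooth_fun_def)

lemma smooth_fun_const: "smooth_atlas A \<Longrightarrow> smooth_fun A (\<lambda>q. c)"
  by (auto simp: smooth_fun_def o_def intro: smooth_on_const smooth_atlasD)

lemma smooth_fun_add:
  "smooth_atlas A \<Longrightarrow> smooth_fun A f \<Longrightarrow> smooth_fun A h \<Longrightarrow> smooth_fun A (\<lambda>q. f q + h q)"
  by (auto simp: smooth_fun_def o_def intro!: smooth_on_add dest: smooth_atlasD)

lemma smooth_fun_mult:
  "smooth_atlas A \<Longrightarrow> smooth_fun A f \<Longrightarrow> smooth_fun A h \<Longrightarrow> smooth_fun A (\<lambda>q. f q * h q)"
  by (auto simp: smooth_fun_def o_def intro!: smooth_on_mult dest: smooth_atlasD)

lemma smooth_fun_diff:
  assumes "smooth_atlas A" "smooth_fun A f" "smooth_fun A h"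
  shows "smooth_fun A (\<lambda>q. f q - h q)"
  using smooth_fun_add[OF assms(1,2) smooth_fun_mult[OF assms(1) smooth_fun_const[OF assms(1)] assms(3)], of "-1"]
  by simp

text \<open>In any other chart \<open>W\<close>, the transition map gives smoothness on the part
  inside \<open>U\<close>, and off the preimage of \<open>K\<close> the function is 0; these two
  open pieces cover \<open>W\<close>.\<close>

lemma smooth_fun_extend_by_zero:
  fixes A :: "('a::t2_space, 'e::euclidean_space) atlas"
  assumes A: "smooth_atlas A" "(U, x) \<in> A"
    and K: "compact K" "K \<subseteq> x ` U" "\<And>z. z \<in> x ` U \<Longrightarrow> z \<notin> K \<Longrightarrow> h z = 0"
    and h: "smooth_on (x ` U) h"
  shows "smooth_fun A (\<lambda>q. if q \<in> U then h (x q) else 0)"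
  unfolding smooth_fun_def
proof (clarify)
  fix W y assume W: "(W, y) \<in> A"
  note DU = smooth_atlasD[OF A] and DW = smooth_atlasD[OF A(1) W]
  let ?f = "(\<lambda>q. if q \<in> U then h (x q) else 0) \<circ> inv_into W y"
  have "compact (inv_into U x ` K)"
    by (rule compact_continuous_image[OF _ K(1)])
      (use DU(3) K(2) continuous_on_subset in \<open>auto simp: homeomorphism_def\<close>)
  \<comment> \<open>A compact set is closed because the manifold is Hausdorff.\<close>
  then have openV: "open (- inv_into U x ` K)"
    by (simp add: compact_imp_closed open_Compl)
  have op: "open (y ` (W \<inter> U))" "open (y ` (W \<inter> - inv_into U x ` K))"
    using chart_image_open[OF A(1) W] DU(1) openV by auto
  have "smooth_on (y ` (W \<inter> U)) (\<lambda>z. h ((x \<circ> inv_into W y) z))"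
    by (rule smooth_on_compose[OF op(1) DU(2) _ h smooth_atlas_transition[OF A(1) W A(2)]])
      (use DW(4) in auto)
  then have s1: "smooth_on (y ` (W \<inter> U)) ?f"
    by (subst smooth_on_cong[OF op(1)]) (use DW(4) in auto)
  have zero: "h (x q) = 0" if "q \<in> U" "q \<notin> inv_into U x ` K" for q
    by (rule K(3)) (use that DU(4) in \<open>auto simp: image_iff\<close>)
  have s2: "smooth_on (y ` (W \<inter> - inv_into U x ` K)) ?f"
    by (subst smooth_on_cong[OF op(2), where g = "\<lambda>_. 0"])
      (use DW(4) zero smooth_on_const[OF op(2)] in auto)
  have "inv_into U x ` K \<subseteq> U"
    using K(2) by (auto intro: inv_into_into)
  then have "W = (W \<inter> U) \<union> (W \<inter> - inv_into U x ` K)"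
    by auto
  then have "y ` W = y ` (W \<inter> U) \<union> y ` (W \<inter> - inv_into U x ` K)"
    by (metis image_Un)
  then show "smooth_on (y ` W) ?f"
    using smooth_on_Un[OF op s1 s2] by simp
qed


subsection \<open>Tangent vectors and vector fields\<close>

lemma tangent_spaceD:
  assumes "v \<in> tangent_space A p"
  shows "\<And>f. \<not> smooth_fun A f \<Longrightarrow> v f = 0"
    and "\<And>f h. smooth_fun A f \<Longrightarrow> smooth_fun A h \<Longrightarrow> v (\<lambda>q. f q + h q) = v f + v h"
    and "\<And>c f. smooth_fun A f \<Longrightarrow> v (\<lambda>q. c * f q) = c * v f"
    and "\<And>f h. smooth_fun A f \<Longrightarrow> smooth_fun A h \<Longrightarrow>
       v (\<lambda>q. f q * h q) = f p * v h + h p * v f"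
  using assms unfolding tangent_space_def by blast+

lemma tangent_space_const:
  assumes "smooth_atlas A" "v \<in> tangent_space A p"
  shows "v (\<lambda>q. c) = 0"
proof -
  \<comment> \<open>The Leibniz rule for \<open>1 * 1\<close> says that this value equals twice
    itself.\<close>
  have "v (\<lambda>q. 1) = 0"
    using tangent_spaceD(4)[OF assms(2), of "\<lambda>q. 1" "\<lambda>q. 1"] smooth_fun_const[OF assms(1)] by simp
  then show ?thesis
    using tangent_spaceD(3)[OF assms(2), of "\<lambda>q. 1" c] smooth_fun_const[OF assms(1)] by simp
qed

lemma subspace_tangent_space: "subspace (tangent_space A p)"
  by (auto simp: subspace_def tangent_space_def algebra_simps)

lemma vector_fieldD:
  assumes "vector_field A X"
  shows "X p \<in> tangent_space A p" "smooth_fun A f \<Longrightarrow> smooth_fun A (\<lambda>p. X p f)"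
  using assms by (auto simp: vector_field_def)

text \<open>Consequently, realising a spanning set of tangent vectors by global fields realises
  every vector in its span.\<close>

lemma subspace_vector_field_values:
  assumes "smooth_atlas A"
  shows "subspace {v. \<exists>X. vector_field A X \<and> X p = v}"
proof -
  have zero: "vector_field A (\<lambda>q. 0)"
    using subspace_0[OF subspace_tangent_space[of A]]
    by (simp add: vector_field_def smooth_fun_const assms)
  have add: "vector_field A (\<lambda>q. X q + Y q)" if "vector_field A X" "vector_field A Y" for X Y
    using that subspace_add[OF subspace_tangent_space[of A]] smooth_fun_add[OF assms]
    by (simp add: vector_field_def)
  have scale: "vector_field A (\<lambda>q. c *\<^sub>R X q)" if "vector_field A X" for X c
    using that subspace_scale[OF subspace_tangent_space[of A]]
      smooth_fun_mult[OF assms smooth_fun_const[OF assms]]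
    by (simp add: vector_field_def)
  show ?thesis
    unfolding subspace_def mem_Collect_eq
  proof (intro conjI ballI allI)
    show "\<exists>X. vector_field A X \<and> X p = 0"
      using zero by (intro exI[of _ "\<lambda>q. 0"]) simp
  next
    fix u v assume "u \<in> {v. \<exists>X. vector_field A X \<and> X p = v}" "v \<in> {v. \<exists>X. vector_field A X \<and> X p = v}"
    then obtain X Y where "vector_field A X" "X p = u" "vector_field A Y" "Y p = v" by blast
    then show "\<exists>X. vector_field A X \<and> X p = u + v"
      using add by (intro exI[of _ "\<lambda>q. X q + Y q"]) simp
  next
    fix c v assume "v \<in> {v. \<exists>X. vector_field A X \<and> X p = v}"
    then obtain X where "vector_field A X" "X p = v" by blast
    then show "\<exists>X. vector_field A X \<and> X p = c *\<^sub>R v"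
      using scale by (intro exI[of _ "\<lambda>q. c *\<^sub>R X q"]) simp
  qed
qed

text \<open>The products of first derivatives arising from the iterated Leibniz rule are symmetric
  in \<open>X\<close> and \<open>Y\<close> and cancel in the commutator.\<close>

lemma vector_field_lie_bracket:
  assumes A: "smooth_atlas A" and X: "vector_field A X" and Y: "vector_field A Y"
  shows "vector_field A (lie_bracket X Y)"
proof -
  have "lie_bracket X Y p \<in> tangent_space A p" for p
  proof -
    note TX = vector_fieldD(1)[OF X] and TY = vector_fieldD(1)[OF Y]
    note SX = vector_fieldD(2)[OF X] and SY = vector_fieldD(2)[OF Y]
    show ?thesis
      unfolding tangent_space_def mem_Collect_eq
    proof (intro conjI allI impI)
      fix f assume "\<not> smooth_fun A f"
      \<comment> \<open>Both inner functions are identically 0 for non-smooth \<open>f\<close>, and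
        derivations annihilate constants.\<close>
      then show "lie_bracket X Y p f = 0"
        by (simp add: lie_bracket_def tangent_spaceD(1)[OF TX] tangent_spaceD(1)[OF TY]
            tangent_space_const[OF A TX] tangent_space_const[OF A TY])
    next
      fix f h assume f: "smooth_fun A f" and h: "smooth_fun A h"
      show "lie_bracket X Y p (\<lambda>q. f q + h q) = lie_bracket X Y p f + lie_bracket X Y p h"
        by (simp add: lie_bracket_def tangent_spaceD(2)[OF TX] tangent_spaceD(2)[OF TY] f h SX SY)
      show "lie_bracket X Y p (\<lambda>q. f q * h q) = f p * lie_bracket X Y p h + h p * lie_bracket X Y p f"
        by (simp add: lie_bracket_def tangent_spaceD(4)[OF TX] tangent_spaceD(4)[OF TY]
            tangent_spaceD(2)[OF TX] tangent_spaceD(2)[OF TY] f h SX SY smooth_fun_mult[OF A] algebra_simps)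
    next
      fix c f assume f: "smooth_fun A f"
      show "lie_bracket X Y p (\<lambda>q. c * f q) = c * lie_bracket X Y p f"
        by (simp add: lie_bracket_def tangent_spaceD(3)[OF TX] tangent_spaceD(3)[OF TY] f SX SY
            algebra_simps)
    qed
  qed
  then show ?thesis
    using smooth_fun_diff[OF A] vector_fieldD(2)[OF X] vector_fieldD(2)[OF Y]
    by (simp add: vector_field_def lie_bracket_def)
qed

section \<open>Coordinate vector fields and their applications\<close>

lemma chart_has_derivative:
  assumes "smooth_fun A f" "(U, x) \<in> A" "q \<in> U"
  shows "(f \<circ> inv_into U x has_derivative frechet_derivative (f \<circ> inv_into U x) (at (x q))) (at (x q))"
  using smooth_on_has_derivative[OF smooth_funD] assms by blast

text \<open>The partial derivatives in a chart are cut off by a bump function and extended by 0;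
  \<open>s\<close> is the value of the bump at \<open>p\<close>. The functions \<open>c j\<close>
  are cut-off coordinates, used as dual functionals to the vectors \<open>E i p\<close>.\<close>

lemma coordinate_fields:
  fixes A :: "('a::t2_space, 'e::euclidean_space) atlas"
  assumes A: "smooth_atlas A" "(U, x) \<in> A" and p: "p \<in> U"
  obtains E :: "'e \<Rightarrow> 'a vfield" and c :: "'e \<Rightarrow> 'a \<Rightarrow> real" and s :: real
  where "s \<noteq> 0" "\<And>i. vector_field A (E i)"
    and "\<And>i f. smooth_fun A f \<Longrightarrow> E i p f = s * frechet_derivative (f \<circ> inv_into U x) (at (x p)) i"
    and "\<And>i j. E i p (c j) = s * s * (i \<bullet> j)"
proof -
  note D = smooth_atlasD[OF A]
  obtain r where r: "r > 0" "cball (x p) r \<subseteq> x ` U"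
    using open_contains_cball D(2) p by blast
  obtain \<beta> :: "'e \<Rightarrow> real" where \<beta>: "smooth_on UNIV \<beta>" "\<beta> (x p) \<noteq> 0"
      "\<And>z. z \<notin> cball (x p) r \<Longrightarrow> \<beta> z = 0"
    using smooth_bump_exists[OF r(1)] by blast
  \<comment> \<open>The value 0 at non-smooth \<open>f\<close> follows the convention of
    \<open>tangent_space\<close>.\<close>
  define E :: "'e \<Rightarrow> 'a vfield" where "E i q f = (if q \<in> U \<and> smooth_fun A f
    then \<beta> (x q) * frechet_derivative (f \<circ> inv_into U x) (at (x q)) i else 0)" for i q f
  define c where "c j q = (if q \<in> U then \<beta> (x q) * ((x q - x p) \<bullet> j) else 0)" for j q
  have bump: "smooth_fun A (\<lambda>q. if q \<in> U then \<beta> (x q) * h (x q) else 0)"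
    if "smooth_on (x ` U) h" for h
    by (rule smooth_fun_extend_by_zero[OF A compact_cball r(2)])
      (use \<beta>(3) that smooth_on_mult[OF D(2) smooth_on_subset[OF \<beta>(1)]] in auto)
  have tangent: "E i q \<in> tangent_space A q" for i q
    unfolding tangent_space_def mem_Collect_eq
  proof (intro conjI allI impI)
    fix f assume "\<not> smooth_fun A f"
    then show "E i q f = 0" by (simp add: E_def)
  next
    fix f h assume f: "smooth_fun A f" and h: "smooth_fun A h"
    show "E i q (\<lambda>q. f q + h q) = E i q f + E i q h"
    proof (cases "q \<in> U")
      case True
      have "((\<lambda>q. f q + h q) \<circ> inv_into U x has_derivative
          (\<lambda>v. frechet_derivative (f \<circ> inv_into U x) (at (x q)) v
            + frechet_derivative (h \<circ> inv_into U x) (at (x q)) v)) (at (x q))"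
        using has_derivative_add[OF chart_has_derivative[OF f A(2) True] chart_has_derivative[OF h A(2) True]]
        by (simp add: o_def)
      from frechet_derivative_at[OF this, symmetric] show ?thesis
        using f h smooth_fun_add[OF A(1) f h] by (simp add: E_def algebra_simps)
    qed (simp add: E_def)
    show "E i q (\<lambda>q. f q * h q) = f q * E i q h + h q * E i q f"
    proof (cases "q \<in> U")
      case True
      have "((\<lambda>q. f q * h q) \<circ> inv_into U x has_derivative
          (\<lambda>v. f q * frechet_derivative (h \<circ> inv_into U x) (at (x q)) v
            + frechet_derivative (f \<circ> inv_into U x) (at (x q)) v * h q)) (at (x q))"
        using has_derivative_mult[OF chart_has_derivative[OF f A(2) True] chart_has_derivative[OF h A(2) True]]
          D(4) True
        by (simp add: o_def)
      from frechet_derivative_at[OF this, symmetric] show ?thesis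
        using f h smooth_fun_mult[OF A(1) f h] by (simp add: E_def algebra_simps)
    qed (simp add: E_def)
  next
    fix k f assume f: "smooth_fun A f"
    show "E i q (\<lambda>q. k * f q) = k * E i q f"
    proof (cases "q \<in> U")
      case True
      have "((\<lambda>q. k * f q) \<circ> inv_into U x has_derivative
          (\<lambda>v. k * frechet_derivative (f \<circ> inv_into U x) (at (x q)) v)) (at (x q))"
        using has_derivative_mult_right[OF chart_has_derivative[OF f A(2) True], of k]
        by (simp add: o_def)
      from frechet_derivative_at[OF this, symmetric] show ?thesis
        using f smooth_fun_mult[OF A(1) smooth_fun_const[OF A(1)] f] by (simp add: E_def)
    qed (simp add: E_def)
  qed
  have field: "vector_field A (E i)" for i
    unfolding vector_field_def
  proof (intro conjI allI impI tangent)
    fix f assume f: "smooth_fun A f"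
    show "smooth_fun A (\<lambda>q. E i q f)"
      using bump[OF smooth_on_frechet_derivative[OF smooth_funD[OF f A(2)]], of i] f
      by (simp add: E_def)
  qed
  have lin: "smooth_on (x ` U) (\<lambda>z. (z - x p) \<bullet> j)" for j
    using smooth_on_add[OF D(2) smooth_on_bounded_linear[OF bounded_linear_inner_left[of j] D(2)]
        smooth_on_const[OF D(2), of "- x p \<bullet> j"]]
    by (simp add: inner_diff_left)
  have smooth_c: "smooth_fun A (c j)" for j
    using bump[OF lin[of j]] by (simp add: c_def[abs_def])
  have dual: "E i p (c j) = \<beta> (x p) * \<beta> (x p) * (i \<bullet> j)" for i j
  proof -
    have "(\<beta> has_derivative frechet_derivative \<beta> (at (x p))) (at (x p))"
      using smooth_on_has_derivative[OF \<beta>(1)] by simp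
    \<comment> \<open>The derivative of \<open>\<beta>\<close> is multiplied by a coordinate centred
      at \<open>p\<close>, which vanishes there. One factor \<open>\<beta> (x p)\<close> remains,
      and \<open>E i\<close> contributes the second.\<close>
    then have "((\<lambda>z. \<beta> z * ((z - x p) \<bullet> j)) has_derivative (\<lambda>v. \<beta> (x p) * (v \<bullet> j))) (at (x p))"
      by (auto intro!: derivative_eq_intros)
    then have "(c j \<circ> inv_into U x has_derivative (\<lambda>v. \<beta> (x p) * (v \<bullet> j))) (at (x p))"
      by (rule has_derivative_transform_within_open[OF _ D(2)])
        (use p D(4) in \<open>auto simp: c_def\<close>)
    from frechet_derivative_at[OF this, symmetric] show ?thesis
      using smooth_c p by (simp add: E_def)
  qed
  show ?thesis
    by (rule that[OF \<beta>(2) field _ dual]) (simp add: E_def p)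
qed

text \<open>\<open>L i\<close> vanishes on every other member of the family, hence on their span,
  but not on \<open>e i\<close>.\<close>

lemma independent_dual_family:
  fixes e :: "'i \<Rightarrow> 'v::real_vector" and L :: "'i \<Rightarrow> 'v \<Rightarrow> real"
  assumes L: "\<And>i. i \<in> I \<Longrightarrow> linear (L i)"
    and dual: "\<And>i j. i \<in> I \<Longrightarrow> j \<in> I \<Longrightarrow> L j (e i) = 0 \<longleftrightarrow> i \<noteq> j"
  shows "independent (e ` I)" "inj_on e I"
proof -
  show inj: "inj_on e I"
    using dual by (metis inj_onI)
  show "independent (e ` I)"
    unfolding dependent_def
  proof clarify
    fix i assume i: "i \<in> I" and "e i \<in> span (e ` I - {e i})"
    moreover have "e ` I - {e i} = e ` (I - {i})"
      using inj i by (auto simp: inj_on_def)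
    ultimately have "L i (e i) = 0"
      using linear_eq_0_on_span[OF L[OF i], of "e ` (I - {i})" "e i"] dual i by auto
    then show False using dual i by blast
  qed
qed

text \<open>By counting: the coordinate fields give \<open>DIM('e)\<close> independent vectors at
  \<open>p\<close>, and \<open>F\<close> leaves no room for one more, so they span the tangent
  space.\<close>

lemma tangent_vector_extends:
  fixes A :: "('a::t2_space, 'e::euclidean_space) atlas"
  assumes A: "smooth_atlas A"
    and F: "finite F" "card F \<le> DIM('e)" "tangent_space A p \<subseteq> span F"
    and v: "v \<in> tangent_space A p"
  obtains X where "vector_field A X" "X p = v"
proof -
  obtain U x where U: "(U, x) \<in> A" "p \<in> U"
    using smooth_atlas_cover[OF A] .
  obtain E :: "'e \<Rightarrow> 'a vfield" and c s where E: "s \<noteq> 0" "\<And>i. vector_field A (E i)"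
      "\<And>i j. E i p (c j) = s * s * (i \<bullet> j)"
    using coordinate_fields[OF A U] by metis
  let ?B = "(\<lambda>i. E i p) ` (Basis :: 'e set)"
  have lin: "linear (\<lambda>w :: 'a tvector. w f)" for f
    by (rule linearI) auto
  have dual: "E i p (c j) = 0 \<longleftrightarrow> i \<noteq> j" if "i \<in> Basis" "j \<in> Basis" for i j
    using that E(1) by (auto simp: E(3) inner_Basis)
  note ind = independent_dual_family[where e = "\<lambda>i. E i p" and L = "\<lambda>j w. w (c j)", OF lin dual]
  have card: "card ?B = DIM('e)"
    using card_image ind(2) by blast
  have subT: "?B \<subseteq> tangent_space A p"
    using vector_fieldD(1)[OF E(2)] by auto
  have "v \<in> span ?B"
  proof (rule ccontr)
    assume nin: "v \<notin> span ?B"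
    then have "independent (insert v ?B)"
      using ind(1) by (simp add: independent_insertI)
    then have "card (insert v ?B) \<le> card F"
      using independent_span_bound[OF F(1)] subT v F(3) by blast
    moreover have "card (insert v ?B) = Suc (DIM('e))"
      using nin span_base card by (metis card_insert_disjoint finite_Basis finite_imageI)
    ultimately show False using F(2) by simp
  qed
  moreover have "span ?B \<subseteq> {v. \<exists>X. vector_field A X \<and> X p = v}"
    by (rule span_minimal[OF _ subspace_vector_field_values[OF A]]) (use E(2) in auto)
  ultimately show ?thesis using that by blast
qed

text \<open>Coordinate fields detect all partial derivatives, so \<open>b\<close> is locally
  constant; connectedness does the rest.\<close>

lemma smooth_fun_constant_if_derivatives_zero:
  fixes A :: "('a::t2_space, 'e::euclidean_space) atlas"
  assumes A: "smooth_atlas A" and conn: "connected (UNIV :: 'a set)" and b: "smooth_fun A b"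
    and zero: "\<And>X p. vector_field A X \<Longrightarrow> X p b = 0"
  obtains c where "\<And>p. b p = c"
proof -
  have "b constant_on UNIV"
  proof (rule locally_constant_imp_constant[OF conn])
    fix p
    obtain U x where U: "(U, x) \<in> A" "p \<in> U"
      using smooth_atlas_cover[OF A] .
    note D = smooth_atlasD[OF A U(1)]
    \<comment> \<open>A coordinate field equals a multiple of the partial derivative only at its
      base point as far as \<open>coordinate_fields\<close> tells, so it is constructed afresh at
      each \<open>q\<close>.\<close>
    have deriv: "(b \<circ> inv_into U x has_derivative (\<lambda>v. 0)) (at (x q))" if q: "q \<in> U" for q
    proof -
      let ?d = "frechet_derivative (b \<circ> inv_into U x) (at (x q))"
      have der: "(b \<circ> inv_into U x has_derivative ?d) (at (x q))"
        by (rule chart_has_derivative[OF b U(1) q])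
      obtain E :: "'e \<Rightarrow> 'a vfield" and s where E: "s \<noteq> 0" "\<And>i. vector_field A (E i)"
          "\<And>i f. smooth_fun A f \<Longrightarrow> E i q f = s * frechet_derivative (f \<circ> inv_into U x) (at (x q)) i"
        using coordinate_fields[OF A U(1) q] by metis
      have "?d = (\<lambda>v. 0)"
        using E(1) zero[OF E(2)] E(3)[OF b] by (metis mult_eq_0_iff)
      then show ?thesis using der by simp
    qed
    obtain r where r: "r > 0" "ball (x p) r \<subseteq> x ` U"
      using open_contains_ball D(2) U(2) by blast
    \<comment> \<open>In the chart this neighbourhood lies in a ball, whose convexity turns a zero
      derivative into constancy.\<close>
    let ?N = "U \<inter> x -` ball (x p) r"
    have "open ?N"
      using D(3) by (intro continuous_open_preimage D(1) open_ball) (simp add: homeomorphism_def)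
    moreover have "b q = b p" if q: "q \<in> ?N" for q
    proof -
      have "\<exists>k. \<forall>z\<in>ball (x p) r. (b \<circ> inv_into U x) z = k"
        by (rule has_derivative_zero_constant[OF convex_ball])
          (use r(2) deriv has_derivative_at_withinI in blast)
      then have "(b \<circ> inv_into U x) (x q) = (b \<circ> inv_into U x) (x p)"
        using q r(1) by (metis IntD2 centre_in_ball vimageE)
      then show ?thesis using q U(2) D(4) by simp
    qed
    moreover have "p \<in> ?N" using U(2) r(1) by simp
    ultimately show "\<exists>T. openin (top_of_set UNIV) T \<and> p \<in> T \<and> (\<forall>q\<in>T. b q = b p)"
      unfolding subtopology_UNIV open_openin[symmetric] by blast
  qed
  then show ?thesis using that by (auto simp: constant_on_def)
qed


subsection \<open>Paracontact metric manifolds\<close>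

locale paracontact_metric_manifold =
  fixes A :: "('a::{t2_space, second_countable_topology}, 'e::euclidean_space) atlas"
    and \<phi> :: "'a endo_field" and \<xi> :: "'a vfield" and \<eta> :: "'a one_form"
    and g :: "'a bilinear_field"
  assumes manifold: "connected_smooth_manifold A"
    and paracontact: "paracontact_metric A \<phi> \<xi> \<eta> g"
begin

abbreviation T where "T \<equiv> tangent_space A"

lemma atlas: "smooth_atlas A"
  using manifold by (simp add: connected_smooth_manifold_def)

lemma almost_paracontact: "almost_paracontact A \<phi> \<xi> \<eta>"
  using paracontact by (simp add: paracontact_metric_def almost_paracontact_metric_def)

lemma xi_field: "vector_field A \<xi>"
  and phi_field: "vector_field A X \<Longrightarrow> vector_field A (\<lambda>p. \<phi> p (X p))"
  and phi_linear: "linear_map_on (T p) (\<phi> p)"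
  and phi_tangent: "v \<in> T p \<Longrightarrow> \<phi> p v \<in> T p"
  and eta_linear: "linear_map_on (T p) (\<eta> p)"
  and eta_xi: "\<eta> p (\<xi> p) = 1"
  and phi_phi: "v \<in> T p \<Longrightarrow> \<phi> p (\<phi> p v) = v - \<eta> p v *\<^sub>R \<xi> p"
  using almost_paracontact
  by (auto simp: almost_paracontact_def endo_field_def one_form_def)

lemma metric: "semi_riemannian_metric A g"
  and phi_metric: "u \<in> T p \<Longrightarrow> v \<in> T p \<Longrightarrow>
    g p (\<phi> p u) (\<phi> p v) = - g p u v + \<eta> p u * \<eta> p v"
  and contact: "vector_field A X \<Longrightarrow> vector_field A Y \<Longrightarrow>
    ext_deriv \<eta> X Y p = g p (X p) (\<phi> p (Y p))"
  using paracontact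
  by (auto simp: paracontact_metric_def almost_paracontact_metric_def fundamental_form_def)

lemma xi_tangent: "\<xi> p \<in> T p"
  using vector_fieldD(1)[OF xi_field] .

section \<open>Pointwise algebra of the structure tensors\<close>

lemma linear_map_on_tangent:
  assumes "linear_map_on (T p) L" "u \<in> T p" "v \<in> T p"
  shows "L (u + v) = L u + L v" "L (c *\<^sub>R v) = c *\<^sub>R L v" "L (u - v) = L u - L v" "L 0 = 0"
proof -
  have add: "L (u + v) = L u + L v" and scale: "L (c *\<^sub>R v) = c *\<^sub>R L v"
    if "u \<in> T p" "v \<in> T p" for u v c
    using assms(1) that unfolding linear_map_on_def by blast+
  show "L (u + v) = L u + L v" "L (c *\<^sub>R v) = c *\<^sub>R L v"
    using add scale assms(2,3) by blast+
  show "L (u - v) = L u - L v"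
    using add[OF assms(2) subspace_scale[OF subspace_tangent_space assms(3), of "-1"]]
      scale[OF assms(3) assms(3), of "-1"] by simp
  show "L 0 = 0"
    using scale[OF assms(3) assms(3), of 0] by simp
qed

lemma xi_nonzero: "\<xi> p \<noteq> 0"
  using eta_xi[of p] linear_map_on_tangent(4)[OF eta_linear xi_tangent xi_tangent, of p] by auto

lemma phi_xi: "\<phi> p (\<xi> p) = 0" and eta_phi: "v \<in> T p \<Longrightarrow> \<eta> p (\<phi> p v) = 0"
proof -
  \<comment> \<open>Two evaluations of \<open>\<phi>\<close> applied three times to
    \<open>v\<close>: the formula for its square is used once inside and once outside.\<close>
  have key: "\<eta> p v *\<^sub>R \<phi> p (\<xi> p) = \<eta> p (\<phi> p v) *\<^sub>R \<xi> p" if v: "v \<in> T p" for v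
  proof -
    have "\<phi> p v - \<eta> p v *\<^sub>R \<phi> p (\<xi> p) = \<phi> p (\<phi> p (\<phi> p v))"
      using phi_phi[OF v] linear_map_on_tangent(2,3)[OF phi_linear] v xi_tangent
        subspace_scale[OF subspace_tangent_space xi_tangent]
      by metis
    also have "\<dots> = \<phi> p v - \<eta> p (\<phi> p v) *\<^sub>R \<xi> p"
      by (rule phi_phi[OF phi_tangent[OF v]])
    finally show ?thesis by simp
  qed
  have eq: "\<phi> p (\<xi> p) = \<eta> p (\<phi> p (\<xi> p)) *\<^sub>R \<xi> p"
    using key[OF xi_tangent] by (simp add: eta_xi)
  have "\<phi> p (\<phi> p (\<xi> p)) = 0"
    using phi_phi[OF xi_tangent] by (simp add: eta_xi)
  \<comment> \<open>By \<open>eq\<close>, \<phi> \<xi> is a multiple of \<xi>. Either its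
    coefficient or \<phi> \<xi> itself is 0 here, and both cases give \<phi> \<xi> = 0.\<close>
  then have "\<eta> p (\<phi> p (\<xi> p)) *\<^sub>R \<phi> p (\<xi> p) = 0"
    using eq linear_map_on_tangent(2)[OF phi_linear xi_tangent xi_tangent] by metis
  then show xi: "\<phi> p (\<xi> p) = 0"
    using eq by (metis scaleR_eq_0_iff)
  show "\<eta> p (\<phi> p v) = 0" if "v \<in> T p"
    using key[OF that] xi xi_nonzero by simp
qed

lemma g_linear: "u \<in> T p \<Longrightarrow> linear_map_on (T p) (g p u)"
  and g_sym: "u \<in> T p \<Longrightarrow> v \<in> T p \<Longrightarrow> g p u v = g p v u"
  and g_nondegenerate: "u \<in> T p \<Longrightarrow> u \<noteq> 0 \<Longrightarrow> \<exists>v\<in>T p. g p u v \<noteq> 0"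
  using metric unfolding semi_riemannian_metric_def by blast+

text \<open>Compatibility with \<xi> as second argument: its left-hand side vanishes since \<phi>
  \<xi> = 0.\<close>

lemma g_xi: "v \<in> T p \<Longrightarrow> g p v (\<xi> p) = \<eta> p v"
  using phi_metric[OF _ xi_tangent, of v] phi_tangent
    linear_map_on_tangent(4)[OF g_linear, of "\<phi> p v" p "\<xi> p" "\<xi> p"] xi_tangent
  by (simp add: phi_xi eta_xi)


section \<open>Eigenspaces of \<phi> and global horizontal fields\<close>

lemma eigenspace_basis:
  assumes "DIM('e) = 2 * n + 1" "n > 0" "s = 1 \<or> s = - 1"
  obtains B where "finite B" "card B = n"
    "{v \<in> T p. \<eta> p v = 0 \<and> \<phi> p v = s *\<^sub>R v} \<subseteq> span B"
    "B \<subseteq> {v \<in> T p. \<eta> p v = 0 \<and> \<phi> p v = s *\<^sub>R v}" "0 \<notin> B"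
proof -
  let ?V = "{v \<in> T p. \<eta> p v = 0 \<and> \<phi> p v = s *\<^sub>R v}"
  have dim: "dim ?V = n"
    using almost_paracontact assms by (auto simp: almost_paracontact_def)
  obtain B where B: "B \<subseteq> ?V" "independent B" "?V \<subseteq> span B" "card B = dim ?V"
    by (rule real_vector.basis_exists)
  \<comment> \<open>\<open>card\<close> is 0 on infinite sets, so the positive cardinality
    \<open>n\<close> forces finiteness.\<close>
  moreover have "finite B"
    using B(4) dim assms(2) card_ge_0_finite[of B] by simp
  moreover have "0 \<notin> B"
    using B(2) dependent_zero by blast
  ultimately show ?thesis
    using that B dim by simp
qed

text \<open>The eigenspace decomposition bounds the dimension of the space of derivations, so that
  Hadamard's lemma is not needed. Positivity of \<open>n\<close> matters because \<^const>\<open>dim\<close> is 0 on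
  infinite-dimensional spaces.\<close>

lemma tangent_space_spanning_set:
  assumes "DIM('e) > 1"
  obtains F where "finite F" "card F \<le> DIM('e)" "T p \<subseteq> span F"
proof -
  obtain n where n: "DIM('e) = 2 * n + 1"
    using almost_paracontact unfolding almost_paracontact_def by blast
  then have n0: "n > 0" using assms by simp
  obtain P where P: "finite P" "card P = n" "{v \<in> T p. \<eta> p v = 0 \<and> \<phi> p v = 1 *\<^sub>R v} \<subseteq> span P"
    using eigenspace_basis[OF n n0, of 1] by blast
  obtain N where N: "finite N" "card N = n" "{v \<in> T p. \<eta> p v = 0 \<and> \<phi> p v = (- 1) *\<^sub>R v} \<subseteq> span N"
    using eigenspace_basis[OF n n0, of "- 1"] by blast
  let ?F = "insert (\<xi> p) (P \<union> N)"
  have "card ?F \<le> DIM('e)"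
    using card_insert_le_m1[of "Suc (card (P \<union> N))" "P \<union> N" "\<xi> p"] card_Un_le[of P N] P(2) N(2) n by simp
  moreover have "v \<in> span ?F" if v: "v \<in> T p" for v
  proof -
    note sub = subspace_add[OF subspace_tangent_space] subspace_diff[OF subspace_tangent_space]
      subspace_scale[OF subspace_tangent_space]
    let ?u = "\<phi> p v" and ?w = "\<phi> p (\<phi> p v)"
    have t: "?u \<in> T p" "?w \<in> T p" using phi_tangent v by auto
    \<comment> \<open>Hence \<open>?w + ?u\<close> and \<open>?w - ?u\<close> are eigenvectors for 1
      and -1. Half their sum is \<open>?w\<close>, which differs from \<open>v\<close> by a multiple
      of \<xi>.\<close>
    have uu: "\<phi> p ?w = ?u"
      using phi_phi[OF t(1)] eta_phi[OF v] by simp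
    have e: "\<eta> p ?u = 0" "\<eta> p ?w = 0"
      using eta_phi v t by auto
    have "?w + ?u \<in> {v \<in> T p. \<eta> p v = 0 \<and> \<phi> p v = 1 *\<^sub>R v}"
      using t sub linear_map_on_tangent(1)[OF phi_linear t(2,1)]
        linear_map_on_tangent(1)[OF eta_linear t(2,1)] uu e by simp
    then have s1: "?w + ?u \<in> span ?F"
      using P(3) span_mono[of P ?F] by blast
    have "?w - ?u \<in> {v \<in> T p. \<eta> p v = 0 \<and> \<phi> p v = (- 1) *\<^sub>R v}"
      using t sub linear_map_on_tangent(3)[OF phi_linear t(2,1)]
        linear_map_on_tangent(3)[OF eta_linear t(2,1)] uu e by simp
    then have s2: "?w - ?u \<in> span ?F"
      using N(3) span_mono[of N ?F] by blast
    have s3: "\<xi> p \<in> span ?F"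
      by (simp add: span_base)
    have "\<eta> p v *\<^sub>R \<xi> p + (1/2) *\<^sub>R ((?w + ?u) + (?w - ?u)) \<in> span ?F"
      by (rule span_add[OF span_scale[OF s3] span_scale[OF span_add[OF s1 s2]]])
    moreover have "(?w + ?u) + (?w - ?u) = ?w + ?w"
      by (simp add: algebra_simps)
    then have "\<eta> p v *\<^sub>R \<xi> p + (1/2) *\<^sub>R ((?w + ?u) + (?w - ?u)) = v"
      using phi_phi[OF v] scaleR_half_double[of ?w] by simp
    ultimately show ?thesis by simp
  qed
  ultimately show ?thesis
    using that[of ?F] P(1) N(1) by blast
qed

text \<open>Nondegeneracy pairs a nonzero eigenvector \<open>u\<close> of \<phi> for the eigenvalue
  1 with some \<open>w\<close>. After extension to fields, applying \<phi> to both makes them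
  horizontal everywhere, not merely at \<open>p\<close>, and keeps the pairing nonzero.\<close>

lemma horizontal_fields_exist:
  assumes "DIM('e) > 1"
  obtains X Y where "vector_field A X" "vector_field A Y" "\<And>q. \<eta> q (X q) = 0" "\<And>q. \<eta> q (Y q) = 0"
    "g p (X p) (\<phi> p (Y p)) \<noteq> 0"
proof -
  obtain F where F: "finite F" "card F \<le> DIM('e)" "T p \<subseteq> span F"
    using tangent_space_spanning_set[OF assms] by blast
  note extend = tangent_vector_extends[OF atlas F]
  obtain n where n: "DIM('e) = 2 * n + 1"
    using almost_paracontact unfolding almost_paracontact_def by blast
  then have n0: "n > 0" using assms by simp
  obtain P where P: "card P = n" "P \<subseteq> {v \<in> T p. \<eta> p v = 0 \<and> \<phi> p v = 1 *\<^sub>R v}" "0 \<notin> P"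
    using eigenspace_basis[OF n n0, of 1] by blast
  then obtain u where "u \<in> P" using n0 by fastforce
  then have u: "u \<in> T p" "\<eta> p u = 0" "\<phi> p u = u" "u \<noteq> 0"
    using P by auto
  obtain w where w: "w \<in> T p" "g p u w \<noteq> 0"
    using g_nondegenerate[OF u(1,4)] by blast
  obtain X where X: "vector_field A X" "X p = u" using extend[OF u(1)] .
  obtain Y where Y: "vector_field A Y" "Y p = w" using extend[OF w(1)] .
  \<comment> \<open>Applying \<phi> twice changes \<open>w\<close> by a multiple of \<xi>, which is
    orthogonal to \<open>u\<close> because \<eta>(u) = 0.\<close>
  have "g p (\<phi> p u) (\<phi> p (\<phi> p w)) = g p u w"
  proof -
    have "g p (\<phi> p u) (\<phi> p (\<phi> p w)) = g p u w - \<eta> p w * g p u (\<xi> p)"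
      using phi_phi[OF w(1)] linear_map_on_tangent[OF g_linear[OF u(1)]] u(3) w(1) xi_tangent
        subspace_scale[OF subspace_tangent_space xi_tangent] by (metis real_scaleR_def)
    then show ?thesis using g_xi[OF u(1)] u(2) by simp
  qed
  then show ?thesis
    using that[OF phi_field[OF X(1)] phi_field[OF Y(1)]] eta_phi vector_fieldD(1)[OF X(1)]
      vector_fieldD(1)[OF Y(1)] w(2) X(2) Y(2) by simp
qed

section \<open>Lie derivative of the metric along a multiple of \<xi>, and constancy of the
  factor\<close>

lemma lie_deriv_fscale_xi:
  assumes b: "smooth_fun A b" and X: "vector_field A X"
  shows "lie_deriv (fscale b \<xi>) g X \<xi> p = X p b + \<xi> p b * \<eta> p (X p)"
proof -
  note TX = vector_fieldD(1)[OF X]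
  \<comment> \<open>The Leibniz rule for \<open>X\<close> on the product of \<open>b\<close> and
    \<xi> f supplies the term with \<open>X p b\<close>. Equality of functionals also has to be
    checked at non-smooth \<open>f\<close>, where both sides are 0.\<close>
  have brX: "lie_bracket (fscale b \<xi>) X p = b p *\<^sub>R lie_bracket \<xi> X p - X p b *\<^sub>R \<xi> p"
    if X: "vector_field A X" for X
  proof
    fix f
    show "lie_bracket (fscale b \<xi>) X p f = (b p *\<^sub>R lie_bracket \<xi> X p - X p b *\<^sub>R \<xi> p) f"
    proof (cases "smooth_fun A f")
      case True
      show ?thesis
        using tangent_spaceD(4)[OF vector_fieldD(1)[OF X] b vector_fieldD(2)[OF xi_field True]]
        by (simp add: lie_bracket_def fscale_def algebra_simps)
    next
      case False
      then show ?thesis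
        using tangent_spaceD(1)[OF vector_fieldD(1)[OF X]] tangent_spaceD(1)[OF vector_fieldD(1)[OF xi_field]]
          tangent_space_const[OF atlas vector_fieldD(1)[OF X]] tangent_space_const[OF atlas vector_fieldD(1)[OF xi_field]]
        by (simp add: lie_bracket_def fscale_def)
    qed
  qed
  have brxi: "lie_bracket \<xi> \<xi> p = 0"
    by (simp add: lie_bracket_def fun_eq_iff)
  have TB: "lie_bracket \<xi> X p \<in> T p"
    using vector_fieldD(1)[OF vector_field_lie_bracket[OF atlas xi_field X]] .
  note scale = subspace_scale[OF subspace_tangent_space]
  have 1: "g p (lie_bracket (fscale b \<xi>) X p) (\<xi> p) = b p * \<eta> p (lie_bracket \<xi> X p) - X p b"
  proof -
    have "g p (lie_bracket (fscale b \<xi>) X p) (\<xi> p) = \<eta> p (b p *\<^sub>R lie_bracket \<xi> X p - X p b *\<^sub>R \<xi> p)"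
      unfolding brX[OF X] by (intro g_xi subspace_diff[OF subspace_tangent_space] scale TB xi_tangent)
    also have "\<dots> = b p * \<eta> p (lie_bracket \<xi> X p) - X p b"
      using linear_map_on_tangent[OF eta_linear] scale TB xi_tangent eta_xi
      by (metis mult.right_neutral real_scaleR_def)
    finally show ?thesis .
  qed
  \<comment> \<open>Since [\<xi>, \<xi>] = 0, only the derivative of \<open>b\<close> survives in
    this bracket.\<close>
  have 2: "g p (X p) (lie_bracket (fscale b \<xi>) \<xi> p) = - \<xi> p b * \<eta> p (X p)"
    using linear_map_on_tangent(2)[OF g_linear[OF TX] xi_tangent xi_tangent, where c = "- \<xi> p b"]
    by (simp add: brX[OF xi_field] brxi g_xi[OF TX])
  have 3: "(\<lambda>q. g q (X q) (\<xi> q)) = (\<lambda>q. \<eta> q (X q))"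
    by (simp add: g_xi TX)
  text \<open>\<open>d\<eta>(\<xi>, X) = g(\<xi>, \<phi>X) = \<eta>(\<phi>X) = 0\<close>\<close>
  have "ext_deriv \<eta> \<xi> X p = 0"
    using contact[OF xi_field X] g_sym[OF xi_tangent phi_tangent[OF TX]] g_xi[OF phi_tangent[OF TX]]
      eta_phi[OF TX] by simp
  \<comment> \<open>In the exterior derivative, \<open>X\<close> differentiates the constant
    \<eta>(\<xi>) = 1. The resulting identity cancels the terms carrying the undifferentiated factor
    \<open>b\<close>.\<close>
  then have "\<xi> p (\<lambda>q. \<eta> q (X q)) = \<eta> p (lie_bracket \<xi> X p)"
    using tangent_space_const[OF atlas TX] by (simp add: ext_deriv_def eta_xi)
  then show ?thesis
    by (simp add: lie_deriv_def 1 2 3) (simp add: fscale_def)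
qed

text \<open>The conformal factor \<open>F\<close> stands for \<lambda> - r; testing the equation
  against \<xi> determines it from \<open>b\<close>.\<close>

lemma conformal_collinear_xi_constant:
  assumes dim: "DIM('e) > 1" and b: "smooth_fun A b"
    and conformal: "\<And>X Y p. vector_field A X \<Longrightarrow> vector_field A Y \<Longrightarrow>
      lie_deriv (fscale b \<xi>) g X Y p = F p * g p (X p) (Y p)"
  obtains c where "\<And>p. b p = c"
proof -
  have eq: "X p b + \<xi> p b * \<eta> p (X p) = F p * \<eta> p (X p)" if "vector_field A X" for X p
    using lie_deriv_fscale_xi[OF b that] conformal[OF that xi_field] g_xi[OF vector_fieldD(1)[OF that]]
    by simp
  have F: "F p = 2 * \<xi> p b" for p
    using eq[OF xi_field, of p] by (simp add: eta_xi)
  have grad: "X p b = \<xi> p b * \<eta> p (X p)" if "vector_field A X" for X p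
    using eq[OF that, of p] by (simp add: F)
  have "\<xi> p b = 0" for p
  proof -
    obtain X Y where X: "vector_field A X" and Y: "vector_field A Y"
      and hor: "\<And>q. \<eta> q (X q) = 0" "\<And>q. \<eta> q (Y q) = 0" and nz: "g p (X p) (\<phi> p (Y p)) \<noteq> 0"
      using horizontal_fields_exist[OF dim] by metis
    note const = tangent_space_const[OF atlas vector_fieldD(1)[OF X]]
      tangent_space_const[OF atlas vector_fieldD(1)[OF Y]]
    \<comment> \<open>By \<open>grad\<close> the functions \<open>X b\<close> and \<open>Y b\<close>
      vanish identically, since \<open>X\<close> and \<open>Y\<close> are horizontal at every point;
      so their derivatives vanish too.\<close>
    have "lie_bracket X Y p b = 0"
      by (simp add: lie_bracket_def grad X Y hor const)
    then have "\<xi> p b * \<eta> p (lie_bracket X Y p) = 0"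
      using grad[OF vector_field_lie_bracket[OF atlas X Y]] by simp
    \<comment> \<open>With \<eta>(X) and \<eta>(Y) identically 0, the contact condition reads -
      \<eta>([X, Y]) / 2 = g(X, \<phi> Y).\<close>
    moreover have "\<eta> p (lie_bracket X Y p) \<noteq> 0"
      using contact[OF X Y, of p] nz by (simp add: ext_deriv_def hor const)
    ultimately show ?thesis by simp
  qed
  then have "X p b = 0" if "vector_field A X" for X p
    using grad[OF that] by simp
  then show ?thesis
    using smooth_fun_constant_if_derivatives_zero[OF atlas _ b] manifold that
    by (auto simp: connected_smooth_manifold_def)
qed

end

theorem proposition1:
  fixes A :: "('a::{t2_space, second_countable_topology}, real ^ 3) atlas"
    and \<phi> :: "'a endo_field" and \<xi> V :: "'a vfield" and \<eta> :: "'a one_form"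
    and g :: "'a bilinear_field" and l :: real and b :: "'a \<Rightarrow> real"
  assumes "para_sasakian A \<phi> \<xi> \<eta> g"
    and "yamabe_soliton A g V l"
    and "smooth_fun A b"
    and "V = (\<lambda>p. b p *\<^sub>R \<xi> p)"
  shows "\<exists>c. (\<forall>p. b p = c) \<and> V = (\<lambda>p. c *\<^sub>R \<xi> p)"
proof -
  interpret paracontact_metric_manifold A \<phi> \<xi> \<eta> g
    using assms(1) by unfold_locales (auto simp: para_sasakian_def)
  have "V = fscale b \<xi>"
    using assms(4) by (simp add: fscale_def)
  then have soliton: "\<And>X Y p. vector_field A X \<Longrightarrow> vector_field A Y \<Longrightarrow>
      lie_deriv (fscale b \<xi>) g X Y p = (l - scalar_curvature A g p) * g p (X p) (Y p)"
    using assms(2) by (simp add: yamabe_soliton_def)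
  \<comment> \<open>The remaining premise is that \<open>DIM(real ^ 3)\<close> exceeds 1.\<close>
  obtain c where "\<And>p. b p = c"
    using conformal_collinear_xi_constant[OF _ assms(3) soliton] by auto
  then show ?thesis
    using assms(4) by auto
qed

end
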